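(* Let $L$ be a finite lattice. Then $L$ is extremal in the generalized sense if and only if $L$ is extremal in the usual sense.
   Context: For a finite lattice $L$, $\mathrm{JI}(L)$ and $\mathrm{MI}(L)$ are the sets of join-irreducible elements (excluding the least element $\hat0$) and meet-irreducible elements (excluding the greatest element $\hat1$); in a finite lattice these agree with the completely join-/meet-irreducible elements $\mathrm{JI}^c(L)$, $\mathrm{MI}^c(L)$. The length of a chain $x_0<\cdots<x_r$ is $r$; the length of $L$ is the maximal length of a chain. Usual sense: $L$ of length $n$ is extremal if $|\mathrm{JI}(L)|=|\mathrm{MI}(L)|=n$. Generalized sense: $L$ is extremal if there are a bijection $\lambda:\mathrm{JI}^c(L)\to\mathrm{MI}^c(L)$ and an inclusion-maximal chain $\mathcal X$ in $L$ such that (a) for every $x\in\mathcal X$ and $j\in\mathrm{JI}^c(L)$ with $j\not\leq x$ we have $x\leq\lambda(j)$; and (b) whenever $x\lessdot y$ is a cover relation with $x,y\in\mathcal X$, there is a unique $j\in\mathrm{JI}^c(L)$ with $j\leq y$ and $j\not\leq x$, there is a unique $m\in\mathrm{MI}^c(L)$ with $x\leq m$ and $y\not\leq m$, and $\lambda(j)=m$. *)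

theory Defs
  imports Main "HOL-Library.Lub_Glb"
begin

definition join_irreducibles :: "'a::lattice set" where
  "join_irreducibles = {j. (\<exists>x. \<not> j \<le> x) \<and> (\<forall>a b. j = sup a b \<longrightarrow> j = a \<or> j = b)}"

definition meet_irreducibles :: "'a::lattice set" where
  "meet_irreducibles = {m. (\<exists>x. \<not> x \<le> m) \<and> (\<forall>a b. m = inf a b \<longrightarrow> m = a \<or> m = b)}"

text \<open>The choice \<open>A = {}\<close> below rules out the least (resp. greatest) element.\<close>

definition completely_join_irreducibles :: "'a::lattice set" where
  "completely_join_irreducibles = {j. \<forall>A. isLub UNIV A j \<longrightarrow> j \<in> A}"

definition completely_meet_irreducibles :: "'a::lattice set" where
  "completely_meet_irreducibles = {m. \<forall>A. isGlb UNIV A m \<longrightarrow> m \<in> A}"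

definition covered_by :: "'a::order \<Rightarrow> 'a \<Rightarrow> bool" (infix "\<lessdot>" 50) where
  "x \<lessdot> y \<longleftrightarrow> x < y \<and> \<not> (\<exists>z. x < z \<and> z < y)"

text \<open>The lattice is the whole type, passed as an argument of type \<^typ>\<open>'a itself\<close>.
  A chain \<open>x 0 < \<dots> < x r\<close> with \<open>r + 1\<close> elements has length \<open>r\<close>.\<close>

definition lattice_length :: "'a::{finite,lattice} itself \<Rightarrow> nat" where
  "lattice_length _ = Max {r. \<exists>x :: nat \<Rightarrow> 'a. strict_mono_on {0..r} x}"

definition extremal :: "'a::{finite,lattice} itself \<Rightarrow> bool" where
  "extremal L \<longleftrightarrow>
     card (join_irreducibles :: 'a set) = lattice_length L \<and>
     card (meet_irreducibles :: 'a set) = lattice_length L"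

definition generalized_extremal :: "'a::lattice itself \<Rightarrow> bool" where
  "generalized_extremal _ \<longleftrightarrow>
     (\<exists>(lam :: 'a \<Rightarrow> 'a) (X :: 'a set).
        bij_betw lam completely_join_irreducibles completely_meet_irreducibles \<and>
        pred_on.maxchain UNIV (<) X \<and>
        (\<forall>x\<in>X. \<forall>j\<in>completely_join_irreducibles. \<not> j \<le> x \<longrightarrow> x \<le> lam j) \<and>
        (\<forall>x\<in>X. \<forall>y\<in>X. x \<lessdot> y \<longrightarrow>
           (\<exists>!j. j \<in> completely_join_irreducibles \<and> j \<le> y \<and> \<not> j \<le> x) \<and>
           (\<exists>!m. m \<in> completely_meet_irreducibles \<and> x \<le> m \<and> \<not> y \<le> m) \<and>
           (\<forall>j\<in>completely_join_irreducibles. \<forall>m\<in>completely_meet_irreducibles.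
              j \<le> y \<and> \<not> j \<le> x \<and> x \<le> m \<and> \<not> y \<le> m \<longrightarrow> lam j = m)))"

end

theory Submission
  imports Defs
begin

text \<open>
  Both notions of extremality compare the irreducible elements with the cover steps
  \<open>x \<lessdot> y\<close> of a maximal chain \<open>X\<close>.  A join-irreducible \<open>j\<close> gives the monotone property
  \<open>j \<le> x\<close> of \<open>x\<close>, a meet-irreducible \<open>m\<close> gives the monotone property \<open>\<not> x \<le> m\<close>; either one
  fails at the bottom of \<open>X\<close> and holds at the top, so it switches from false to true at
  exactly one step of \<open>X\<close> (\<open>unique_switch\<close>).  Conversely every step is the switching point
  of some \<open>j\<close> and of some \<open>m\<close>, because irreducibles separate the elements of a finite
  lattice (\<open>separating_join_irreducible\<close>, \<open>separating_meet_irreducible\<close>).  So sending an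
  irreducible to its switching step is a surjection onto the \<open>card X - 1\<close> steps, and it is a
  bijection iff every step has a unique join- (or meet-) irreducible, which is the uniqueness
  demanded in the generalized sense (\<open>join_irreducibles_count\<close>, \<open>meet_irreducibles_count\<close>).

  If \<open>L\<close> is extremal in the generalized sense, then both kinds of irreducibles are
  equinumerous with the steps of some maximal chain, whose number is at most the length of
  \<open>L\<close>; surjectivity for a longest chain gives the opposite inequality.  If \<open>L\<close> is extremal in
  the usual sense, take a longest chain \<open>X\<close>: by counting, both surjections are bijections, and
  \<open>\<lambda>\<close> matches the \<open>j\<close> and the \<open>m\<close> that switch at the same step of \<open>X\<close>.
\<close>

section \<open>Irreducible elements of a finite lattice\<close>

lemma isLub_Sup_fin:
  fixes A :: "'a::lattice set"
  assumes "finite A" "A \<noteq> {}"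
  shows "isLub UNIV A (Sup_fin A)"
  using assms by (auto intro!: isLubI2 setleI setgeI Sup_fin.coboundedI Sup_fin.boundedI
    dest: isUbD simp: isUb_def setle_def)

lemma isGlb_Inf_fin:
  fixes A :: "'a::lattice set"
  assumes "finite A" "A \<noteq> {}"
  shows "isGlb UNIV A (Inf_fin A)"
  using assms
  by (auto simp: isGlb_def greatestP_def isLb_def setge_def setle_def
    intro: Inf_fin.coboundedI Inf_fin.boundedI)

lemma Sup_fin_join_irreducible_mem:
  fixes A :: "'a::lattice set"
  assumes "finite A" "A \<noteq> {}" "Sup_fin A \<in> join_irreducibles"
  shows "Sup_fin A \<in> A"
  using assms
proof (induction A rule: finite_ne_induct)
  case (insert a A)
  have "Sup_fin (insert a A) = sup a (Sup_fin A)"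
    using insert.hyps by simp
  then have "Sup_fin (insert a A) = a \<or> Sup_fin (insert a A) = Sup_fin A"
    using insert.prems by (auto simp: join_irreducibles_def)
  then show ?case
    using insert.IH insert.prems by auto
qed simp

lemma Inf_fin_meet_irreducible_mem:
  fixes A :: "'a::lattice set"
  assumes "finite A" "A \<noteq> {}" "Inf_fin A \<in> meet_irreducibles"
  shows "Inf_fin A \<in> A"
  using assms
proof (induction A rule: finite_ne_induct)
  case (insert a A)
  have "Inf_fin (insert a A) = inf a (Inf_fin A)"
    using insert.hyps by simp
  then have "Inf_fin (insert a A) = a \<or> Inf_fin (insert a A) = Inf_fin A"
    using insert.prems by (auto simp: meet_irreducibles_def)
  then show ?case
    using insert.IH insert.prems by auto
qed simp

text \<open>Complete irreducibility of \<open>j\<close> at \<open>A = {}\<close> says that \<open>j\<close> is not the least element, and at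
  \<open>A = {a, b}\<close> it is the binary condition; the latter extends to all nonempty finite \<open>A\<close> by
  induction.\<close>

lemma completely_join_irreducibles_finite:
  "completely_join_irreducibles = (join_irreducibles :: 'a::{finite,lattice} set)"
proof (intro equalityI subsetI)
  fix j :: 'a
  assume j: "j \<in> completely_join_irreducibles"
  then have mem: "j \<in> A" if "isLub UNIV A j" for A
    using that by (auto simp: completely_join_irreducibles_def)
  have "\<not> isLub UNIV {} j"
    using mem by blast
  then have "\<exists>x. \<not> j \<le> x"
    by (auto simp: isLub_def leastP_def isUb_def setle_def setge_def)
  moreover have "j = a \<or> j = b" if "j = sup a b" for a b
    using mem[of "{a, b}"] isLub_Sup_fin[of "{a, b}"] that by auto
  ultimately show "j \<in> join_irreducibles"
    by (auto simp: join_irreducibles_def)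
next
  fix j :: 'a
  assume j: "j \<in> join_irreducibles"
  have "j \<in> A" if lub: "isLub UNIV A j" for A
  proof -
    have "A \<noteq> {}"
      using lub j
      by (auto simp: join_irreducibles_def isLub_def leastP_def isUb_def setle_def setge_def)
    moreover from this have "j = Sup_fin A"
      using lub isLub_Sup_fin[of A]
      by (auto simp: isLub_def leastP_def setge_def intro: order.antisym)
    ultimately show ?thesis
      using Sup_fin_join_irreducible_mem[of A] j by simp
  qed
  then show "j \<in> completely_join_irreducibles"
    by (simp add: completely_join_irreducibles_def)
qed

lemma completely_meet_irreducibles_finite:
  "completely_meet_irreducibles = (meet_irreducibles :: 'a::{finite,lattice} set)"
proof (intro equalityI subsetI)
  fix m :: 'a
  assume m: "m \<in> completely_meet_irreducibles"
  then have mem: "m \<in> A" if "isGlb UNIV A m" for A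
    using that by (auto simp: completely_meet_irreducibles_def)
  have "\<not> isGlb UNIV {} m"
    using mem by blast
  then have "\<exists>x. \<not> x \<le> m"
    by (auto simp: isGlb_def greatestP_def isLb_def setle_def setge_def)
  moreover have "m = a \<or> m = b" if "m = inf a b" for a b
    using mem[of "{a, b}"] isGlb_Inf_fin[of "{a, b}"] that by auto
  ultimately show "m \<in> meet_irreducibles"
    by (auto simp: meet_irreducibles_def)
next
  fix m :: 'a
  assume m: "m \<in> meet_irreducibles"
  have "m \<in> A" if glb: "isGlb UNIV A m" for A
  proof -
    have "A \<noteq> {}"
      using glb m
      by (auto simp: meet_irreducibles_def isGlb_def greatestP_def isLb_def setle_def setge_def)
    moreover from this have "m = Inf_fin A"
      using glb isGlb_Inf_fin[of A]
      by (auto simp: isGlb_def greatestP_def setle_def intro: order.antisym)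
    ultimately show ?thesis
      using Inf_fin_meet_irreducible_mem[of A] m by simp
  qed
  then show "m \<in> completely_meet_irreducibles"
    by (simp add: completely_meet_irreducibles_def)
qed

text \<open>A minimal witness of \<open>\<not> y \<le> x\<close> below \<open>y\<close> is join-irreducible: were it the join of two
  smaller elements, both would be below \<open>x\<close>, and so would their join.\<close>

lemma separating_join_irreducible:
  fixes x y :: "'a::{finite,lattice}"
  assumes "\<not> y \<le> x"
  shows "\<exists>j\<in>join_irreducibles. j \<le> y \<and> \<not> j \<le> x"
proof -
  have "finite {z. z \<le> y \<and> \<not> z \<le> x}" "{z. z \<le> y \<and> \<not> z \<le> x} \<noteq> {}"
    using assms by auto
  then obtain j where j: "j \<le> y" "\<not> j \<le> x"
    and min: "\<And>z. z \<le> y \<Longrightarrow> \<not> z \<le> x \<Longrightarrow> z \<le> j \<Longrightarrow> j = z"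
    using finite_has_minimal[of "{z. z \<le> y \<and> \<not> z \<le> x}"] by auto
  have "j = a \<or> j = b" if ab: "j = sup a b" for a b
  proof (rule ccontr)
    assume "\<not> (j = a \<or> j = b)"
    moreover have "a \<le> j" "b \<le> j"
      using ab by simp_all
    ultimately have "a \<le> x" "b \<le> x"
      using min j(1) order_trans by blast+
    then show False
      using ab j(2) by simp
  qed
  then show ?thesis
    using j by (auto simp: join_irreducibles_def)
qed

lemma separating_meet_irreducible:
  fixes x y :: "'a::{finite,lattice}"
  assumes "\<not> y \<le> x"
  shows "\<exists>m\<in>meet_irreducibles. x \<le> m \<and> \<not> y \<le> m"
proof -
  have "finite {z. x \<le> z \<and> \<not> y \<le> z}" "{z. x \<le> z \<and> \<not> y \<le> z} \<noteq> {}"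
    using assms by auto
  then obtain m where m: "x \<le> m" "\<not> y \<le> m"
    and max: "\<And>z. x \<le> z \<Longrightarrow> \<not> y \<le> z \<Longrightarrow> m \<le> z \<Longrightarrow> m = z"
    using finite_has_maximal[of "{z. x \<le> z \<and> \<not> y \<le> z}"] by auto
  have "m = a \<or> m = b" if ab: "m = inf a b" for a b
  proof (rule ccontr)
    assume "\<not> (m = a \<or> m = b)"
    moreover have "m \<le> a" "m \<le> b"
      using ab by simp_all
    ultimately have "y \<le> a" "y \<le> b"
      using max m(1) order_trans by blast+
    then show False
      using ab m(2) by simp
  qed
  then show ?thesis
    using m by (auto simp: meet_irreducibles_def)
qed

section \<open>Steps of a maximal chain\<close>

lemma maxchain_comparable:
  fixes X :: "'a::order set"
  assumes "pred_on.maxchain UNIV (<) X" "x \<in> X" "y \<in> X"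
  shows "x \<le> y \<or> y \<le> x"
  using assms unfolding pred_on.maxchain_def pred_on.chain_def by (blast intro: less_imp_le eq_refl)

lemma maxchain_memI:
  fixes X :: "'a::order set"
  assumes X: "pred_on.maxchain UNIV (<) X" and comp: "\<And>x. x \<in> X \<Longrightarrow> z \<le> x \<or> x \<le> z"
  shows "z \<in> X"
proof (rule ccontr)
  assume z: "z \<notin> X"
  have "pred_on.chain UNIV (<) (insert z X)"
    using X comp unfolding pred_on.maxchain_def pred_on.chain_def by (auto simp: order.order_iff_strict)
  then show False
    using X z unfolding pred_on.maxchain_def by blast
qed

lemma maxchain_least:
  fixes X :: "'a::{finite,lattice} set"
  assumes "pred_on.maxchain UNIV (<) X"
  shows "Inf_fin UNIV \<in> X"
  by (rule maxchain_memI[OF assms]) (simp add: Inf_fin.coboundedI)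

lemma maxchain_greatest:
  fixes X :: "'a::{finite,lattice} set"
  assumes "pred_on.maxchain UNIV (<) X"
  shows "Sup_fin UNIV \<in> X"
  by (rule maxchain_memI[OF assms]) (simp add: Sup_fin.coboundedI)

definition cover_steps :: "'a::order set \<Rightarrow> ('a \<times> 'a) set" where
  "cover_steps X = {(x, y). x \<in> X \<and> y \<in> X \<and> x \<lessdot> y}"

definition switches_at :: "('a \<Rightarrow> bool) \<Rightarrow> 'a \<times> 'a \<Rightarrow> bool" where
  "switches_at P s \<longleftrightarrow> \<not> P (fst s) \<and> P (snd s)"

text \<open>The step goes from the last element of the chain where \<open>P\<close> fails to the first one where
  it holds.  These form a cover in the whole lattice, as any element strictly between
  them would be comparable with the whole chain and hence belong to it.\<close>

lemma unique_switch:
  fixes X :: "'a::{finite,lattice} set"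
  assumes X: "pred_on.maxchain UNIV (<) X"
    and P: "mono P" "\<exists>x. P x" "\<exists>x. \<not> P x"
  shows "\<exists>!s. s \<in> cover_steps X \<and> switches_at P s"
proof -
  note comp = maxchain_comparable[OF X]
  have up: "P y" if "P x" "x \<le> y" for x y
    using monoD[OF P(1) that(2)] that(1) by simp
  have "\<not> P (Inf_fin UNIV)" "P (Sup_fin UNIV)"
    using P up by (meson Inf_fin.coboundedI Sup_fin.coboundedI finite UNIV_I)+
  then have ne: "{x \<in> X. \<not> P x} \<noteq> {}" "{x \<in> X. P x} \<noteq> {}"
    using maxchain_least[OF X] maxchain_greatest[OF X] by auto
  obtain x where x: "x \<in> X" "\<not> P x" and xmax: "\<And>z. z \<in> X \<Longrightarrow> \<not> P z \<Longrightarrow> x \<le> z \<Longrightarrow> x = z"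
    using finite_has_maximal[OF _ ne(1)] by auto
  obtain y where y: "y \<in> X" "P y" and ymin: "\<And>z. z \<in> X \<Longrightarrow> P z \<Longrightarrow> z \<le> y \<Longrightarrow> y = z"
    using finite_has_minimal[OF _ ne(2)] by auto
  have below: "z \<le> x" if "z \<in> X" "\<not> P z" for z
    using comp[OF x(1) that(1)] xmax that by blast
  have above: "y \<le> z" if "z \<in> X" "P z" for z
    using comp[OF y(1) that(1)] ymin that by blast
  have "x < y"
    using comp[OF x(1) y(1)] x y up by (auto simp: order.order_iff_strict)
  moreover have False if "x < z" "z < y" for z
  proof -
    have "z \<in> X"
    proof (rule maxchain_memI[OF X])
      fix w
      assume "w \<in> X"
      then have "w \<le> x \<or> y \<le> w"
        using below above by blast
      then show "z \<le> w \<or> w \<le> z"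
        using that by (meson less_imp_le order_trans)
    qed
    then have "z \<le> x \<or> y \<le> z"
      using below above by blast
    then show False
      using that by (meson leD)
  qed
  ultimately have cover: "x \<lessdot> y"
    by (auto simp: covered_by_def)
  show ?thesis
  proof (rule ex1I[of _ "(x, y)"])
    show "(x, y) \<in> cover_steps X \<and> switches_at P (x, y)"
      using cover x y by (simp add: cover_steps_def switches_at_def)
  next
    fix s
    assume s: "s \<in> cover_steps X \<and> switches_at P s"
    obtain u v where uv: "s = (u, v)"
      by (cases s)
    have u: "u \<in> X" "\<not> P u" and v: "v \<in> X" "P v" and uv_cover: "u \<lessdot> v"
      using s by (simp_all add: uv cover_steps_def switches_at_def)
    have "u \<le> x" "y \<le> v"
      using below[OF u] above[OF v] by simp_all
    then have "u = x" "y = v"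
      using uv_cover \<open>x < y\<close> unfolding covered_by_def
      by (meson le_less order_less_le_trans order_le_less_trans)+
    then show "s = (x, y)"
      by (simp add: uv)
  qed
qed

text \<open>Such a relation is the graph of a surjection from \<open>S\<close> to \<open>T\<close>, and a surjection between
  finite sets is injective iff they have the same size.\<close>

lemma card_functional_relation:
  assumes fin: "finite S" "finite T"
    and fn: "\<And>s. s \<in> S \<Longrightarrow> \<exists>!t. t \<in> T \<and> R s t"
    and onto: "\<And>t. t \<in> T \<Longrightarrow> \<exists>s\<in>S. R s t"
  shows "card T \<le> card S" "card S = card T \<longleftrightarrow> (\<forall>t\<in>T. \<exists>!s. s \<in> S \<and> R s t)"
proof -
  define f where "f s = (THE t. t \<in> T \<and> R s t)" for s
  have f: "f s \<in> T" "R s (f s)" if "s \<in> S" for s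
    using theI'[OF fn[OF that]] by (auto simp: f_def)
  have f_eq: "f s = t" if "s \<in> S" "t \<in> T" "R s t" for s t
    using fn[OF that(1)] f[OF that(1)] that by blast
  have image: "f ` S = T"
  proof (intro equalityI subsetI)
    fix t
    assume t: "t \<in> T"
    then obtain s where "s \<in> S" "R s t"
      using onto by blast
    then show "t \<in> f ` S"
      using f_eq t by blast
  qed (use f in auto)
  show "card T \<le> card S"
    using surj_card_le[of S T f] fin image by simp
  have "card S = card T \<longleftrightarrow> inj_on f S"
    using inj_on_iff_eq_card[OF fin(1), of f] image by auto
  also have "\<dots> \<longleftrightarrow> (\<forall>t\<in>T. \<exists>!s. s \<in> S \<and> R s t)"
  proof
    assume "inj_on f S"
    then show "\<forall>t\<in>T. \<exists>!s. s \<in> S \<and> R s t"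
      using onto f_eq by (metis inj_onD)
  next
    assume "\<forall>t\<in>T. \<exists>!s. s \<in> S \<and> R s t"
    then show "inj_on f S"
      by (intro inj_onI) (metis f)
  qed
  finally show "card S = card T \<longleftrightarrow> (\<forall>t\<in>T. \<exists>!s. s \<in> S \<and> R s t)" .
qed

text \<open>The element \<open>z\<close> of the chain enters at the step that ends in \<open>z\<close>, so every step is
  the switching point of a unique element of \<open>X\<close> other than the least one.\<close>

lemma card_cover_steps:
  fixes X :: "'a::{finite,lattice} set"
  assumes X: "pred_on.maxchain UNIV (<) X"
  shows "card (cover_steps X) = card X - 1"
proof -
  let ?b = "Inf_fin UNIV :: 'a"
  let ?S = "X - {?b}"
  have b: "?b \<le> x" for x
    by (simp add: Inf_fin.coboundedI)
  have unique: "\<exists>!z. z \<in> ?S \<and> switches_at ((\<le>) z) s" if s: "s \<in> cover_steps X" for s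
  proof -
    obtain x y where xy: "s = (x, y)" "x \<in> X" "y \<in> X" "x \<lessdot> y"
      using s by (auto simp: cover_steps_def)
    have "x < y"
      using xy by (simp add: covered_by_def)
    show ?thesis
    proof (rule ex1I[of _ y])
      show "y \<in> ?S \<and> switches_at ((\<le>) y) s"
        using xy \<open>x < y\<close> b[of x] by (auto simp: switches_at_def)
    next
      fix z
      assume z: "z \<in> ?S \<and> switches_at ((\<le>) z) s"
      then have "z \<le> y" "\<not> z \<le> x" "z \<in> X"
        by (auto simp: xy switches_at_def)
      moreover from this have "x < z"
        using maxchain_comparable[OF X, of x z] xy by (auto simp: order.order_iff_strict)
      ultimately show "z = y"
        using xy by (auto simp: covered_by_def order.order_iff_strict)
    qed
  qed
  have "\<exists>!s. s \<in> cover_steps X \<and> switches_at ((\<le>) z) s" if "z \<in> ?S" for z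
  proof (rule unique_switch[OF X])
    show "\<exists>x. \<not> z \<le> x"
      using that b by (intro exI[of _ ?b]) (auto simp: order.antisym)
  qed (auto intro!: monoI intro: order_trans)
  then have "card ?S = card (cover_steps X)"
    using card_functional_relation(2)[of ?S "cover_steps X" "\<lambda>z. switches_at ((\<le>) z)"] unique
    by (simp add: ex1_implies_ex Bex_def)
  then show ?thesis
    using maxchain_least[OF X] by (simp add: card_Diff_singleton)
qed

lemma join_irreducible_unique_switch:
  fixes X :: "'a::{finite,lattice} set"
  assumes X: "pred_on.maxchain UNIV (<) X" and j: "j \<in> join_irreducibles"
  shows "\<exists>!s. s \<in> cover_steps X \<and> switches_at ((\<le>) j) s"
  using j by (intro unique_switch[OF X]) (auto simp: join_irreducibles_def intro!: monoI intro: order_trans)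

lemma meet_irreducible_unique_switch:
  fixes X :: "'a::{finite,lattice} set"
  assumes X: "pred_on.maxchain UNIV (<) X" and m: "m \<in> meet_irreducibles"
  shows "\<exists>!s. s \<in> cover_steps X \<and> switches_at (\<lambda>x. \<not> x \<le> m) s"
  using m by (intro unique_switch[OF X]) (auto simp: meet_irreducibles_def intro!: monoI intro: order_trans)

lemma join_irreducibles_count:
  fixes X :: "'a::{finite,lattice} set"
  assumes X: "pred_on.maxchain UNIV (<) X"
  shows "card X - 1 \<le> card (join_irreducibles :: 'a set)"
    and "card (join_irreducibles :: 'a set) = card X - 1 \<longleftrightarrow>
      (\<forall>s\<in>cover_steps X. \<exists>!j. j \<in> join_irreducibles \<and> switches_at ((\<le>) j) s)"
proof -
  have "\<exists>j\<in>join_irreducibles. switches_at ((\<le>) j) s" if "s \<in> cover_steps X" for s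
    using that separating_join_irreducible[of "snd s" "fst s"]
    by (auto simp: cover_steps_def covered_by_def switches_at_def less_le_not_le)
  note card = card_functional_relation[OF finite finite join_irreducible_unique_switch[OF X] this]
  show "card X - 1 \<le> card (join_irreducibles :: 'a set)"
    using card(1) by (simp add: card_cover_steps[OF X])
  show "card (join_irreducibles :: 'a set) = card X - 1 \<longleftrightarrow>
      (\<forall>s\<in>cover_steps X. \<exists>!j. j \<in> join_irreducibles \<and> switches_at ((\<le>) j) s)"
    using card(2) by (simp add: card_cover_steps[OF X])
qed

lemma meet_irreducibles_count:
  fixes X :: "'a::{finite,lattice} set"
  assumes X: "pred_on.maxchain UNIV (<) X"
  shows "card (meet_irreducibles :: 'a set) = card X - 1 \<longleftrightarrow>
      (\<forall>s\<in>cover_steps X. \<exists>!m. m \<in> meet_irreducibles \<and> switches_at (\<lambda>x. \<not> x \<le> m) s)"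
proof -
  have "\<exists>m\<in>meet_irreducibles. switches_at (\<lambda>x. \<not> x \<le> m) s" if "s \<in> cover_steps X" for s
    using that separating_meet_irreducible[of "snd s" "fst s"]
    by (auto simp: cover_steps_def covered_by_def switches_at_def less_le_not_le)
  note card = card_functional_relation[OF finite finite meet_irreducible_unique_switch[OF X] this]
  show ?thesis
    using card(2) by (simp add: card_cover_steps[OF X])
qed

section \<open>Length and maximal chains\<close>

lemma chain_enumeration:
  fixes C :: "'a::{finite,order} set"
  assumes "pred_on.chain UNIV (<) C" "card C = Suc r"
  shows "\<exists>x. strict_mono_on {0..r} x \<and> x ` {0..r} \<subseteq> C"
  using assms
proof (induction r arbitrary: C)
  case 0
  then obtain c where "C = {c}"
    by (auto simp: card_Suc_eq)
  then show ?case
    by (intro exI[of _ "\<lambda>_. c"]) (auto simp: strict_mono_on_def)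
next
  case (Suc r)
  have "C \<noteq> {}"
    using Suc.prems(2) by auto
  then obtain g where g: "g \<in> C" and gmax: "\<And>z. z \<in> C \<Longrightarrow> g \<le> z \<Longrightarrow> g = z"
    using finite_has_maximal[of C] by auto
  have less_g: "z < g" if "z \<in> C - {g}" for z
  proof -
    have "z < g \<or> g < z"
      using Suc.prems(1) g that unfolding pred_on.chain_def by auto
    then show ?thesis
      using gmax[of z] that by (auto dest: less_imp_le)
  qed
  have "pred_on.chain UNIV (<) (C - {g})" "card (C - {g}) = Suc r"
    using Suc.prems g unfolding pred_on.chain_def by auto
  then obtain x where x: "strict_mono_on {0..r} x" "x ` {0..r} \<subseteq> C - {g}"
    using Suc.IH by blast
  let ?x = "x(Suc r := g)"
  have "?x k < ?x l" if "k < l" "l \<le> Suc r" for k l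
  proof (cases "l = Suc r")
    case True
    then show ?thesis
      using that less_g[of "x k"] x(2) by (auto simp: image_subset_iff)
  next
    case False
    then show ?thesis
      using that strict_mono_onD[OF x(1), of k l] by simp
  qed
  then have "strict_mono_on {0..Suc r} ?x"
    by (intro strict_mono_onI) simp
  moreover have "?x ` {0..Suc r} \<subseteq> C"
    using x(2) g by (force simp: le_Suc_eq)
  ultimately show ?case
    by blast
qed

lemma card_strict_mono_image:
  fixes x :: "nat \<Rightarrow> 'a::order"
  assumes "strict_mono_on {0..r} x"
  shows "card (x ` {0..r}) = Suc r"
  using card_image[OF strict_mono_on_imp_inj_on[OF assms]] by simp

lemma finite_chain_lengths:
  "finite {r. \<exists>x :: nat \<Rightarrow> 'a::{finite,lattice}. strict_mono_on {0..r} x}"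
proof (rule finite_subset)
  show "{r. \<exists>x :: nat \<Rightarrow> 'a. strict_mono_on {0..r} x} \<subseteq> {..card (UNIV :: 'a set)}"
  proof clarsimp
    fix r and x :: "nat \<Rightarrow> 'a"
    assume "strict_mono_on {0..r} x"
    then have "Suc r \<le> card (UNIV :: 'a set)"
      using card_strict_mono_image[of r x] card_mono[of UNIV "x ` {0..r}"] by simp
    then show "r \<le> card (UNIV :: 'a set)"
      by simp
  qed
qed simp

lemma chain_card_le_length:
  fixes C :: "'a::{finite,lattice} set"
  assumes "pred_on.chain UNIV (<) C"
  shows "card C \<le> Suc (lattice_length TYPE('a))"
proof (cases "card C")
  case (Suc r)
  then have "r \<in> {r. \<exists>x :: nat \<Rightarrow> 'a. strict_mono_on {0..r} x}"
    using chain_enumeration[OF assms Suc] by blast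
  then have "r \<le> lattice_length TYPE('a)"
    unfolding lattice_length_def by (rule Max_ge[OF finite_chain_lengths])
  then show ?thesis
    using Suc by simp
qed simp

text \<open>The length is attained by some chain, and enlarging that chain would exceed the length.\<close>

lemma longest_maxchain:
  obtains X :: "'a::{finite,lattice} set"
  where "pred_on.maxchain UNIV (<) X" "card X = Suc (lattice_length TYPE('a))"
proof -
  let ?n = "lattice_length TYPE('a)"
  have "strict_mono_on {0..0::nat} (\<lambda>_. undefined :: 'a)"
    by (auto simp: strict_mono_on_def)
  then have "{r. \<exists>x :: nat \<Rightarrow> 'a. strict_mono_on {0..r} x} \<noteq> {}"
    by blast
  then have "?n \<in> {r. \<exists>x :: nat \<Rightarrow> 'a. strict_mono_on {0..r} x}"
    unfolding lattice_length_def by (rule Max_in[OF finite_chain_lengths])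
  then obtain x :: "nat \<Rightarrow> 'a" where x: "strict_mono_on {0..?n} x"
    by blast
  let ?X = "x ` {0..?n}"
  have card: "card ?X = Suc ?n"
    by (rule card_strict_mono_image[OF x])
  have "pred_on.chain UNIV (<) ?X"
    unfolding pred_on.chain_def
  proof (intro conjI ballI)
    fix a b
    assume "a \<in> ?X" "b \<in> ?X"
    then obtain k l where "k \<in> {0..?n}" "l \<in> {0..?n}" "a = x k" "b = x l"
      by blast
    then show "(<)\<^sup>=\<^sup>= a b \<or> (<)\<^sup>=\<^sup>= b a"
      using strict_mono_onD[OF x, of k l] strict_mono_onD[OF x, of l k]
      by (cases k l rule: linorder_cases) auto
  qed simp
  moreover have False if "pred_on.chain UNIV (<) S" "?X \<subset> S" for S
    using chain_card_le_length[OF that(1)] psubset_card_mono[OF _ that(2)] card by simp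
  ultimately have "pred_on.maxchain UNIV (<) ?X"
    unfolding pred_on.maxchain_def by blast
  then show thesis
    using card that by blast
qed

section \<open>The two notions of extremality\<close>

lemma generalized_extremal_imp_extremal:
  assumes "generalized_extremal TYPE('a::{finite,lattice})"
  shows "extremal TYPE('a)"
proof -
  from assms obtain lam :: "'a \<Rightarrow> 'a" and X :: "'a set"
    where X: "pred_on.maxchain UNIV (<) X"
      and steps: "\<forall>x\<in>X. \<forall>y\<in>X. x \<lessdot> y \<longrightarrow>
        (\<exists>!j. j \<in> join_irreducibles \<and> j \<le> y \<and> \<not> j \<le> x) \<and>
        (\<exists>!m. m \<in> meet_irreducibles \<and> x \<le> m \<and> \<not> y \<le> m) \<and>
        (\<forall>j\<in>join_irreducibles. \<forall>m\<in>meet_irreducibles.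
          j \<le> y \<and> \<not> j \<le> x \<and> x \<le> m \<and> \<not> y \<le> m \<longrightarrow> lam j = m)"
    unfolding generalized_extremal_def completely_join_irreducibles_finite
      completely_meet_irreducibles_finite
    by (elim exE conjE)
  have unique: "(\<exists>!j. j \<in> join_irreducibles \<and> switches_at ((\<le>) j) s) \<and>
      (\<exists>!m. m \<in> meet_irreducibles \<and> switches_at (\<lambda>x. \<not> x \<le> m) s)"
    if s: "s \<in> cover_steps X" for s
  proof -
    have "switches_at ((\<le>) j) s \<longleftrightarrow> j \<le> snd s \<and> \<not> j \<le> fst s"
      and "switches_at (\<lambda>x. \<not> x \<le> m) s \<longleftrightarrow> fst s \<le> m \<and> \<not> snd s \<le> m" for j m
      by (auto simp: switches_at_def)
    moreover have "fst s \<in> X" "snd s \<in> X" "fst s \<lessdot> snd s"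
      using s by (auto simp: cover_steps_def)
    ultimately show ?thesis
      using steps by simp
  qed
  have J: "card (join_irreducibles :: 'a set) = card X - 1"
    unfolding join_irreducibles_count(2)[OF X] using unique by blast
  have M: "card (meet_irreducibles :: 'a set) = card X - 1"
    unfolding meet_irreducibles_count[OF X] using unique by blast
  have "card X - 1 \<le> lattice_length TYPE('a)"
    using X chain_card_le_length[of X] by (simp add: pred_on.maxchain_def)
  moreover have "lattice_length TYPE('a) \<le> card (join_irreducibles :: 'a set)"
  proof -
    obtain Y :: "'a set" where "pred_on.maxchain UNIV (<) Y"
      and "card Y = Suc (lattice_length TYPE('a))"
      by (rule longest_maxchain)
    then show ?thesis
      using join_irreducibles_count(1)[of Y] by simp
  qed
  ultimately show ?thesis
    using J M by (simp add: extremal_def)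
qed

lemma extremal_imp_generalized_extremal:
  assumes ext: "extremal TYPE('a::{finite,lattice})"
  shows "generalized_extremal TYPE('a)"
proof -
  let ?J = "join_irreducibles :: 'a set"
  let ?M = "meet_irreducibles :: 'a set"
  obtain X :: "'a set" where X: "pred_on.maxchain UNIV (<) X"
    and cardX: "card X = Suc (lattice_length TYPE('a))"
    by (rule longest_maxchain)
  define at_j where "at_j s j \<longleftrightarrow> j \<in> ?J \<and> switches_at ((\<le>) j) s" for s j
  define at_m where "at_m s m \<longleftrightarrow> m \<in> ?M \<and> switches_at (\<lambda>x. \<not> x \<le> m) s" for s m
  have uj: "\<exists>!j. at_j s j" and um: "\<exists>!m. at_m s m" if "s \<in> cover_steps X" for s
    using that join_irreducibles_count(2)[OF X] meet_irreducibles_count[OF X] ext cardX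
    by (simp_all add: extremal_def at_j_def at_m_def)
  have js: "\<exists>!s. s \<in> cover_steps X \<and> at_j s j" if "j \<in> ?J" for j
    using join_irreducible_unique_switch[OF X that] that by (simp add: at_j_def)
  have ms: "\<exists>!s. s \<in> cover_steps X \<and> at_m s m" if "m \<in> ?M" for m
    using meet_irreducible_unique_switch[OF X that] that by (simp add: at_m_def)
  define lam where "lam j = (THE m. \<exists>s\<in>cover_steps X. at_j s j \<and> at_m s m)" for j
  have lam: "lam j = m" if "s \<in> cover_steps X" "at_j s j" "at_m s m" for s j m
    unfolding lam_def
  proof (rule the_equality)
    fix m'
    assume "\<exists>s\<in>cover_steps X. at_j s j \<and> at_m s m'"
    then obtain t where t: "t \<in> cover_steps X" "at_j t j" "at_m t m'"
      by blast
    have "j \<in> ?J"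
      using that(2) by (simp add: at_j_def)
    then have "t = s"
      using js that t by blast
    then show "m' = m"
      using um that t by blast
  qed (use that in blast)
  have lam_ex: "\<exists>s\<in>cover_steps X. at_j s j \<and> at_m s (lam j)" if "j \<in> ?J" for j
    using js[OF that] um lam by metis
  have bij: "bij_betw lam ?J ?M"
    unfolding bij_betw_def
  proof
    show "inj_on lam ?J"
    proof (rule inj_onI)
      fix i j
      assume ij: "i \<in> ?J" "j \<in> ?J" "lam i = lam j"
      obtain s t where s: "s \<in> cover_steps X" "at_j s i" "at_m s (lam i)"
        and t: "t \<in> cover_steps X" "at_j t j" "at_m t (lam j)"
        using lam_ex ij by meson
      have "lam i \<in> ?M"
        using s by (simp add: at_m_def)
      then have "s = t"
        using ms s t ij(3) by metis
      then show "i = j"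
        using uj s t by blast
    qed
    show "lam ` ?J = ?M"
    proof (intro equalityI subsetI)
      fix m
      assume "m \<in> lam ` ?J"
      then show "m \<in> ?M"
        using lam_ex by (auto simp: at_m_def)
    next
      fix m
      assume "m \<in> ?M"
      then obtain s where s: "s \<in> cover_steps X" "at_m s m"
        using ms by blast
      then obtain j where j: "at_j s j"
        using uj by blast
      then show "m \<in> lam ` ?J"
        using lam[OF s(1) j s(2)] by (auto simp: at_j_def)
    qed
  qed
  have below_lam: "x \<le> lam j" if x: "x \<in> X" and j: "j \<in> ?J" "\<not> j \<le> x" for x j
  proof -
    obtain u v where uv: "(u, v) \<in> cover_steps X" "at_j (u, v) j" "at_m (u, v) (lam j)"
      using lam_ex[OF j(1)] by auto
    have "\<not> v \<le> x"
      using uv(2) j(2) by (auto simp: at_j_def switches_at_def)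
    then have "x < v"
      using maxchain_comparable[OF X x, of v] uv(1)
      by (auto simp: cover_steps_def order.order_iff_strict)
    \<comment> \<open>\<open>x\<close> lies in the chain strictly before the end of the step \<open>u \<lessdot> v\<close>, so not after \<open>u\<close>.\<close>
    then have "x \<le> u"
      using maxchain_comparable[OF X x, of u] uv(1)
      by (auto simp: cover_steps_def covered_by_def order.order_iff_strict)
    also have "u \<le> lam j"
      using uv(3) by (simp add: at_m_def switches_at_def)
    finally show ?thesis .
  qed
  have steps: "(\<exists>!j. j \<in> ?J \<and> j \<le> y \<and> \<not> j \<le> x) \<and>
      (\<exists>!m. m \<in> ?M \<and> x \<le> m \<and> \<not> y \<le> m) \<and>
      (\<forall>j\<in>?J. \<forall>m\<in>?M. j \<le> y \<and> \<not> j \<le> x \<and> x \<le> m \<and> \<not> y \<le> m \<longrightarrow> lam j = m)"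
    if "x \<in> X" "y \<in> X" "x \<lessdot> y" for x y
  proof -
    have s: "(x, y) \<in> cover_steps X"
      using that by (simp add: cover_steps_def)
    have "at_j (x, y) j \<longleftrightarrow> j \<in> ?J \<and> j \<le> y \<and> \<not> j \<le> x"
      and "at_m (x, y) m \<longleftrightarrow> m \<in> ?M \<and> x \<le> m \<and> \<not> y \<le> m" for j m
      by (auto simp: at_j_def at_m_def switches_at_def)
    then show ?thesis
      using uj[OF s] um[OF s] lam[OF s] by simp
  qed
  show ?thesis
    unfolding generalized_extremal_def completely_join_irreducibles_finite
      completely_meet_irreducibles_finite
    using bij X below_lam steps by (intro exI[of _ lam] exI[of _ X]) blast
qed

theorem lemma3p4:
  shows "generalized_extremal TYPE('a::{finite,lattice}) \<longleftrightarrow> extremal TYPE('a)"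
  using generalized_extremal_imp_extremal extremal_imp_generalized_extremal by blast

end
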